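(* Let $p$ be a prime, let $\psi\in C(\mathbb{Z}_p,\mathbb{C}_p)$, and let $\mathscr{I}(\psi):\mathbb{Z}_p\to\mathbb{C}_p$ be the locally analytic function $\mathscr{I}(\psi)(s) = \sum_{n=0}^\infty n!\,\psi(-1-n)\binom{s}{n}$. Then for all $s\in\mathbb{Z}_p$, $$\mathscr{I}(\psi)(s) = \int_{\mathbb{Z}_p}(\mathbf{1}-\beta_1)^{\star s}\,d\mu(H_\psi) = \int_{\mathbb{Z}_p}\Big((\mathbf{1}-\beta_1)^{\star s}\star\psi\Big)\,d\mu(H_{\mathbf{1}}) .$$
   Context: $C(\mathbb{Z}_p,\mathbb{C}_p)$ is the $\mathbb{C}_p$-vector space of continuous functions $\mathbb{Z}_p \to \mathbb{C}_p$. For $n\ge0$, $\beta_n(x) = \binom{x}{n}$ (so $\beta_1(x)=x$), and $\mathbf{1}$ is the constant function $1$. Every $\phi \in C(\mathbb{Z}_p,\mathbb{C}_p)$ is uniquely $\sum_{n\ge0}a_n\beta_n$ with $a_n \in \mathbb{C}_p$, $a_n\to0$ (Mahler coefficients). A power series $G(t) = \sum_{n\ge0}b_nt^n \in \mathbb{C}_p[[t]]$ with bounded coefficients defines a measure (bounded linear functional on $C(\mathbb{Z}_p,\mathbb{C}_p)$) $\mu(G)$ by $\int_{\mathbb{Z}_p}\phi\,d\mu(G) = \sum_{n\ge0}a_nb_n$, where $(a_n)$ are the Mahler coefficients of $\phi$. For $\psi \in C(\mathbb{Z}_p,\mathbb{C}_p)$, $H_\psi(t) = \sum_{n\ge0}(-1)^n\psi(-1-n)t^n$.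 The product $\star$ on $C(\mathbb{Z}_p,\mathbb{C}_p)$ is $\phi\star\psi = \sum_{n\ge0}\big(\sum_{k=0}^n\binom{n}{k}a_kb_{n-k}\big)\beta_n$, where $(a_k),(b_l)$ are the Mahler coefficients of $\phi,\psi$. For $s\in\mathbb{Z}_p$, $(\mathbf{1}-\beta_1)^{\star s}$ is defined to be the continuous function $\sum_{n=0}^\infty(-1)^n\binom{s}{n}n!\,\beta_n$ (for $s\in\mathbb{Z}$ this agrees with the $s$th power of $\mathbf{1}-\beta_1$ with respect to $\star$). *)

theory Defs
  imports "HOL-Analysis.Analysis" "HOL-Computational_Algebra.Computational_Algebra"
begin

text \<open>
  The field of complex \<open>p\<close>-adic numbers is not available as a library type. It is treated as an
  arbitrary model: a type \<open>'k\<close> that is a field and a complete metric space and that satisfies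
  \<open>is_complex_padics\<close> below, i.e. that is the completion of an algebraic closure of the
  completion of the rationals with respect to the \<open>p\<close>-adic absolute value. Such a field exists and
  is unique up to isometric isomorphism. Its absolute value is the distance to zero.
\<close>

definition padic_abs_rat :: "nat \<Rightarrow> rat \<Rightarrow> real" where
  "padic_abs_rat p q =
     (if q = 0 then 0
      else real p powi (int (multiplicity (int p) (snd (quotient_of q)))
                        - int (multiplicity (int p) (fst (quotient_of q)))))"

abbreviation vabs :: "'k::{field_char_0,metric_space} \<Rightarrow> real" where
  "vabs x \<equiv> dist x 0"

definition padic_rats :: "'k::{field_char_0,metric_space} set" where
  "padic_rats = closure (range of_rat)"

definition padic_ints :: "'k::{field_char_0,metric_space} set" where
  "padic_ints = {x \<in> padic_rats. vabs x \<le> 1}"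

definition padic_algebraic :: "'k::{field_char_0,metric_space} set" where
  "padic_algebraic = {x. \<exists>f. f \<noteq> 0 \<and> (\<forall>i. coeff f i \<in> padic_rats) \<and> poly f x = 0}"

text \<open>
  Completeness of \<open>'k\<close> is part of its sort. In such a field the closure of the rationals is the
  \<open>p\<close>-adic field, by the fourth condition; the fifth condition makes the set of elements algebraic
  over it an algebraic closure of it, and the last one says that \<open>'k\<close> is the completion of that.
\<close>

definition is_complex_padics :: "nat \<Rightarrow> 'k::{field_char_0,complete_space} itself \<Rightarrow> bool" where
  "is_complex_padics p K \<longleftrightarrow>
     (\<forall>x y :: 'k. dist x y = vabs (x - y)) \<and>
     (\<forall>x y :: 'k. vabs (x * y) = vabs x * vabs y) \<and>
     (\<forall>x y :: 'k. vabs (x + y) \<le> max (vabs x) (vabs y)) \<and>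
     (\<forall>q. vabs (of_rat q :: 'k) = padic_abs_rat p q) \<and>
     (\<forall>f :: 'k poly. degree f > 0 \<and> (\<forall>i. coeff f i \<in> padic_algebraic) \<longrightarrow>
        (\<exists>x \<in> padic_algebraic. poly f x = 0)) \<and>
     closure (padic_algebraic :: 'k set) = UNIV"

text \<open>
  Functions on the \<open>p\<close>-adic integers are represented by functions on \<open>'k\<close>; their values outside
  \<open>padic_ints\<close> are irrelevant. The binomial function of degree \<open>n\<close> at \<open>x\<close> is \<open>x gchoose n\<close>.
\<close>

definition padic_continuous :: "('k::{field_char_0,metric_space} \<Rightarrow> 'k) set" where
  "padic_continuous = {\<phi>. continuous_on padic_ints \<phi>}"

definition mahler_coeff :: "('k::{field_char_0,metric_space} \<Rightarrow> 'k) \<Rightarrow> nat \<Rightarrow> 'k" where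
  "mahler_coeff \<phi> =
     (THE a. a \<longlonglongrightarrow> 0 \<and> (\<forall>x \<in> padic_ints. (\<lambda>n. a n * (x gchoose n)) sums \<phi> x))"

text \<open>
  \<open>padic_measure G \<phi>\<close> is the integral of \<open>\<phi>\<close> with respect to the measure given by \<open>G\<close>. It is
  meaningful for continuous \<open>\<phi>\<close> and power series \<open>G\<close> with bounded coefficients.
\<close>

definition padic_measure ::
    "'k::{field_char_0,metric_space} fps \<Rightarrow> ('k \<Rightarrow> 'k) \<Rightarrow> 'k" where
  "padic_measure G \<phi> = (\<Sum>n. mahler_coeff \<phi> n * fps_nth G n)"

definition H_series :: "('k::field_char_0 \<Rightarrow> 'k) \<Rightarrow> 'k fps" where
  "H_series \<psi> = Abs_fps (\<lambda>n. (-1) ^ n * \<psi> (-1 - of_nat n))"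

definition mahler_star ::
    "('k::{field_char_0,metric_space} \<Rightarrow> 'k) \<Rightarrow> ('k \<Rightarrow> 'k) \<Rightarrow> 'k \<Rightarrow> 'k"  (infixl "\<star>" 70) where
  "\<phi> \<star> \<psi> =
     (\<lambda>x. \<Sum>n. (\<Sum>k\<le>n. of_nat (n choose k) * mahler_coeff \<phi> k * mahler_coeff \<psi> (n - k))
              * (x gchoose n))"

text \<open>The \<open>\<star>\<close>-power of \<open>1 - x\<close> with exponent \<open>s\<close>, which may be any \<open>p\<close>-adic integer.\<close>

definition one_minus_star_power :: "'k::{field_char_0,metric_space} \<Rightarrow> 'k \<Rightarrow> 'k" where
  "one_minus_star_power s = (\<lambda>x. \<Sum>n. (-1) ^ n * (s gchoose n) * fact n * (x gchoose n))"

definition I_transform :: "('k::{field_char_0,metric_space} \<Rightarrow> 'k) \<Rightarrow> 'k \<Rightarrow> 'k" where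
  "I_transform \<psi> s = (\<Sum>n. fact n * \<psi> (-1 - of_nat n) * (s gchoose n))"

definition padic_locally_analytic :: "('k::{field_char_0,metric_space} \<Rightarrow> 'k) \<Rightarrow> bool" where
  "padic_locally_analytic f \<longleftrightarrow>
     (\<forall>a \<in> padic_ints. \<exists>r > 0. \<exists>c. \<forall>x \<in> padic_ints. dist x a < r \<longrightarrow>
        (\<lambda>n. c n * (x - a) ^ n) sums f x)"

end

theory Submission
  imports Defs
begin

text \<open>
  Since Mahler coefficients are unique, those of \<open>one_minus_star_power s\<close> can be read off its
  definition once they are known to tend to 0, so its integral against \<open>H_series \<psi>\<close> is the series of
  \<open>I_transform \<psi> s\<close> term by term: the two signs \<open>(-1) ^ n\<close> cancel.

  For the second integral, let \<open>a\<close> and \<open>b\<close> be the Mahler coefficients of a function \<open>\<phi>\<close> and of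
  \<open>\<psi>\<close>. Expanding \<open>\<psi> (-1 - k)\<close> by Mahler's theorem and using
  \<open>(-1 - k) gchoose l = (-1) ^ l * ((k + l) choose k)\<close>, the integral of \<open>\<phi>\<close> against
  \<open>H_series \<psi>\<close> becomes the double series of
  \<open>(-1) ^ (k + l) * ((k + l) choose k) * a k * b l\<close>, summed first over \<open>l\<close>. Summed along the
  antidiagonals \<open>k + l = n\<close>, it is the integral of \<open>\<phi> \<star> \<psi>\<close> against \<open>H_series 1\<close>. In a complete
  ultrametric field both orders of summation agree as soon as the terms tend to 0
  (\<open>null_family_rows_sums_antidiagonals\<close>), and here they are bounded by \<open>vabs (a k) * vabs (b l)\<close>.

  Local analyticity comes from the same interchange. The polynomial \<open>fact n * (x gchoose n)\<close> is a
  product of \<open>n\<close> consecutive factors \<open>x - i\<close>. On a disc of radius \<open>1 / p\<close> around a \<open>p\<close>-adic integer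
  all these factors have Gauss norm at most 1, and one out of any \<open>p\<close> consecutive ones has Gauss norm
  \<open>1 / p\<close>. So the Gauss norms tend to 0 (\<open>gauss_bound_tendsto_0\<close>), and the series may be rearranged
  by powers of \<open>x - a\<close>. The case of the constant coefficient says that \<open>fact n * (s gchoose n)\<close>
  tends to 0.

  Mahler's theorem itself (\<open>mahler_expansion\<close>) is proved by Bojanic's argument: uniform continuity
  and the divisibility of the inner binomial coefficients of order \<open>p ^ t\<close> by \<open>p\<close> force the iterated
  differences at 0 to tend to 0.
\<close>

section \<open>Series in complete ultrametric fields\<close>

locale ultrametric_field =
  fixes K :: "'k::{field_char_0,complete_space} itself"
  assumes dist_vabs: "dist (x::'k) y = vabs (x - y)"
    and vabs_mult: "vabs (x * y :: 'k) = vabs x * vabs y"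
    and vabs_add: "vabs (x + y :: 'k) \<le> max (vabs x) (vabs y)"
begin

lemma vabs_1: "vabs (1::'k) = 1"
  using vabs_mult[of 1 1] by simp

lemma vabs_minus: "vabs (- x :: 'k) = vabs x"
proof -
  have "vabs (-1::'k) * vabs (-1::'k) = 1"
    using vabs_mult[of "-1" "-1"] vabs_1 by simp
  hence "vabs (-1::'k) = 1"
    using abs_square_eq_1[of "vabs (-1::'k)"] by (simp add: power2_eq_square)
  thus ?thesis using vabs_mult[of "-1" x] by simp
qed

lemma vabs_diff: "vabs (x - y :: 'k) \<le> max (vabs x) (vabs y)"
  using vabs_add[of x "- y"] by (simp add: vabs_minus)

lemma vabs_diff_commute: "vabs (x - y :: 'k) = vabs (y - x)"
  using vabs_minus[of "x - y"] by simp

lemma vabs_power: "vabs (x ^ n :: 'k) = vabs x ^ n"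
  by (induction n) (auto simp: vabs_1 vabs_mult)

lemma vabs_prod: "vabs (\<Prod>i\<in>A. f i :: 'k) = (\<Prod>i\<in>A. vabs (f i))"
  by (induction A rule: infinite_finite_induct) (auto simp: vabs_1 vabs_mult)

lemma vabs_divide: "y \<noteq> 0 \<Longrightarrow> vabs (x / y :: 'k) = vabs x / vabs y"
  using vabs_mult[of "x / y" y] by (simp add: field_simps)

lemma vabs_sum_le:
  assumes "0 \<le> c" "\<And>i. i \<in> A \<Longrightarrow> vabs (f i :: 'k) \<le> c"
  shows "vabs (\<Sum>i\<in>A. f i) \<le> c"
  using assms(2)
proof (induction A rule: infinite_finite_induct)
  case (insert x F)
  have "vabs (f x + sum f F) \<le> max (vabs (f x)) (vabs (sum f F))" by (rule vabs_add)
  also have "\<dots> \<le> c" using insert by simp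
  finally show ?case using insert by simp
qed (use assms(1) in auto)

lemma vabs_of_nat_le_1: "vabs (of_nat n :: 'k) \<le> 1"
  using vabs_sum_le[of 1 "{..<n}" "\<lambda>_. 1"] vabs_1 by simp

lemma vabs_of_int_le_1: "vabs (of_int n :: 'k) \<le> 1"
  by (cases n) (simp_all add: vabs_of_nat_le_1 vabs_minus del: of_nat_Suc)

lemma tendsto_0_iff_vabs: "f \<longlonglongrightarrow> (0::'k) \<longleftrightarrow> (\<lambda>n. vabs (f n)) \<longlonglongrightarrow> 0"
  by (rule tendsto_dist_iff)

lemma tendsto_0_if_vabs_le:
  assumes "\<And>n. vabs (f n :: 'k) \<le> b n" "b \<longlonglongrightarrow> 0"
  shows "f \<longlonglongrightarrow> 0"
  unfolding tendsto_0_iff_vabs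
  by (rule tendsto_sandwich[OF _ _ tendsto_const assms(2)]) (use assms(1) in auto)

lemma tendsto_0_mult_bounded:
  assumes "f \<longlonglongrightarrow> (0::'k)" "\<And>n. vabs (g n) \<le> M"
  shows "(\<lambda>n. f n * g n) \<longlonglongrightarrow> (0::'k)"
proof -
  have "(\<lambda>n. vabs (f n) * M) \<longlonglongrightarrow> 0"
    using tendsto_mult_right[of "\<lambda>n. vabs (f n)" 0 sequentially M] assms(1)
    by (simp add: tendsto_0_iff_vabs)
  moreover have "vabs (f n * g n) \<le> vabs (f n) * M" for n
    by (simp add: vabs_mult mult_left_mono assms(2))
  ultimately show ?thesis by (rule tendsto_0_if_vabs_le[rotated])
qed

lemma sums_mult_left:
  assumes "f sums (s::'k)"
  shows "(\<lambda>n. c * f n) sums (c * s)"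
proof -
  have "(\<lambda>n. vabs c * dist (\<Sum>i<n. f i) s) \<longlonglongrightarrow> 0"
    using assms unfolding sums_def tendsto_dist_iff[of _ s] by (rule tendsto_mult_right_zero)
  moreover have "vabs c * dist (\<Sum>i<n. f i) s = dist (\<Sum>i<n. c * f i) (c * s)" for n
    by (simp add: dist_vabs[of _ s] dist_vabs[of _ "c * s"] vabs_mult[symmetric]
        sum_distrib_left right_diff_distrib)
  ultimately show ?thesis
    unfolding sums_def tendsto_dist_iff[of _ "c * s"] by simp
qed

text \<open>By the ultrametric inequality a block of terms is no larger than its largest term.\<close>

lemma null_imp_summable:
  assumes "f \<longlonglongrightarrow> (0::'k)"
  shows "summable f"
proof -
  have "Cauchy (\<lambda>n. \<Sum>i<n. f i)"
  proof (rule metric_CauchyI)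
    fix e :: real assume e: "e > 0"
    then obtain N where N: "\<And>n. n \<ge> N \<Longrightarrow> vabs (f n) < e / 2"
      using metric_LIMSEQ_D[OF assms, of "e / 2"] by auto
    have *: "dist (\<Sum>i<m. f i) (\<Sum>i<N. f i) \<le> e / 2" if "m \<ge> N" for m
    proof -
      have "(\<Sum>i<m. f i) - (\<Sum>i<N. f i) = (\<Sum>i\<in>{..<m} - {..<N}. f i)"
        using that by (subst sum_diff) auto
      also have "vabs \<dots> \<le> e / 2"
        by (rule vabs_sum_le) (use e N in \<open>auto intro: less_imp_le\<close>)
      finally show ?thesis by (simp add: dist_vabs[of "\<Sum>i<m. f i"])
    qed
    have "dist (\<Sum>i<m. f i) (\<Sum>i<n. f i) < e" if "m \<ge> N" "n \<ge> N" for m n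
    proof -
      have "vabs ((\<Sum>i<m. f i) - (\<Sum>i<N. f i) - ((\<Sum>i<n. f i) - (\<Sum>i<N. f i))) \<le> e / 2"
        using vabs_diff[of "(\<Sum>i<m. f i) - (\<Sum>i<N. f i)" "(\<Sum>i<n. f i) - (\<Sum>i<N. f i)"]
          *[OF that(1)] *[OF that(2)]
        unfolding dist_vabs[of "\<Sum>i<m. f i"] dist_vabs[of "\<Sum>i<n. f i"] by linarith
      thus ?thesis using e by (simp add: dist_vabs[of "\<Sum>i<m. f i" "\<Sum>i<n. f i"])
    qed
    thus "\<exists>M. \<forall>m\<ge>M. \<forall>n\<ge>M. dist (\<Sum>i<m. f i) (\<Sum>i<n. f i) < e" by blast
  qed
  thus ?thesis
    unfolding summable_def sums_def by (meson Cauchy_convergent convergent_def)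
qed

lemma vabs_diff_sums_le:
  assumes "f sums (s::'k)" "\<And>i. i \<ge> N \<Longrightarrow> vabs (f i) \<le> c" "0 \<le> c"
  shows "vabs (s - (\<Sum>i<N. f i)) \<le> c"
proof -
  have "(\<lambda>n. dist (\<Sum>i<n. f i) (\<Sum>i<N. f i)) \<longlonglongrightarrow> dist s (\<Sum>i<N. f i)"
    using assms(1) unfolding sums_def by (intro tendsto_dist tendsto_const)
  moreover have "dist (\<Sum>i<n. f i) (\<Sum>i<N. f i) \<le> c" if "n \<ge> N" for n
  proof -
    have "(\<Sum>i<n. f i) - (\<Sum>i<N. f i) = (\<Sum>i\<in>{..<n} - {..<N}. f i)"
      using that by (subst sum_diff) auto
    thus ?thesis
      using vabs_sum_le[of c "{..<n} - {..<N}" f] assms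
      by (simp add: dist_vabs[of "\<Sum>i<n. f i"])
  qed
  ultimately have "dist s (\<Sum>i<N. f i) \<le> c"
    by (intro LIMSEQ_le_const2) auto
  thus ?thesis by (simp add: dist_vabs[of s])
qed

end

text \<open>
  This is convergence to 0 along the cofinite filter on pairs of indices: for each \<open>e\<close> all terms
  outside a square \<open>{..<N} \<times> {..<N}\<close> are at most \<open>e\<close>.
\<close>

definition null_family :: "(nat \<Rightarrow> nat \<Rightarrow> 'k::{field_char_0,metric_space}) \<Rightarrow> bool" where
  "null_family f \<longleftrightarrow> (\<forall>e>0. \<exists>N. \<forall>k l. N \<le> k \<or> N \<le> l \<longrightarrow> vabs (f k l) \<le> e)"

lemma null_family_swap: "null_family f \<Longrightarrow> null_family (\<lambda>k l. f l k)"
  unfolding null_family_def by meson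

context ultrametric_field
begin

lemma null_family_row:
  assumes "null_family (f :: nat \<Rightarrow> nat \<Rightarrow> 'k)"
  shows "f k \<longlonglongrightarrow> 0"
proof (rule metric_LIMSEQ_I)
  fix e :: real assume "e > 0"
  then obtain N where N: "\<And>l. N \<le> l \<Longrightarrow> vabs (f k l) \<le> e / 2"
    using assms unfolding null_family_def by (meson half_gt_zero)
  have "vabs (f k n) < e" if "n \<ge> N" for n
    using N[OF that] \<open>e > 0\<close> by linarith
  thus "\<exists>N. \<forall>n\<ge>N. dist (f k n) 0 < e" by blast
qed

lemma null_family_antidiagonal:
  assumes "null_family (f :: nat \<Rightarrow> nat \<Rightarrow> 'k)"
  shows "(\<lambda>n. \<Sum>k\<le>n. f k (n - k)) \<longlonglongrightarrow> 0"
proof (rule metric_LIMSEQ_I)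
  fix e :: real assume e: "e > 0"
  then obtain N where N: "\<And>k l. N \<le> k \<or> N \<le> l \<Longrightarrow> vabs (f k l) \<le> e / 2"
    using assms unfolding null_family_def by (meson half_gt_zero)
  have "vabs (\<Sum>k\<le>n. f k (n - k)) < e" if n: "n \<ge> 2 * N" for n
  proof -
    have "vabs (\<Sum>k\<le>n. f k (n - k)) \<le> e / 2"
    proof (rule vabs_sum_le)
      fix k assume "k \<in> {..n}"
      have "N \<le> k \<or> N \<le> n - k" using n by linarith
      thus "vabs (f k (n - k)) \<le> e / 2" by (rule N)
    qed (use e in auto)
    thus ?thesis using e by simp
  qed
  thus "\<exists>N. \<forall>n\<ge>N. dist (\<Sum>k\<le>n. f k (n - k)) 0 < e" by blast
qed

text \<open>
  Both iterated sums are compared with the sum over a large square. All terms that are missing on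
  either side lie outside a fixed smaller square, so they are small, and hence so is their sum.
\<close>

lemma null_family_rows_sums_antidiagonals:
  assumes "null_family (f :: nat \<Rightarrow> nat \<Rightarrow> 'k)"
  shows "(\<lambda>k. \<Sum>l. f k l) sums (\<Sum>n. \<Sum>k\<le>n. f k (n - k))"
proof -
  define S where "S = (\<Sum>n. \<Sum>k\<le>n. f k (n - k))"
  have S: "(\<lambda>n. \<Sum>k\<le>n. f k (n - k)) sums S"
    unfolding S_def
    by (rule summable_sums, rule null_imp_summable, rule null_family_antidiagonal, fact)
  have row: "f k sums (\<Sum>l. f k l)" for k
    by (rule summable_sums, rule null_imp_summable, rule null_family_row, fact)
  have "(\<lambda>m. \<Sum>k<m. \<Sum>l. f k l) \<longlonglongrightarrow> S"
  proof (rule metric_LIMSEQ_I)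
    fix e :: real assume e: "e > 0"
    then obtain N where N: "\<And>k l. N \<le> k \<or> N \<le> l \<Longrightarrow> vabs (f k l) \<le> e / 2"
      using assms unfolding null_family_def by (meson half_gt_zero)
    have "dist (\<Sum>k<m. \<Sum>l. f k l) S < e" if m: "m \<ge> 2 * N" for m
    proof -
      let ?R = "\<Sum>k<m. \<Sum>l. f k l" and ?Q = "\<Sum>k<m. \<Sum>l<m. f k l"
        and ?T = "\<Sum>n<m. \<Sum>k\<le>n. f k (n - k)"
      have "?R - ?Q = (\<Sum>k<m. (\<Sum>l. f k l) - (\<Sum>l<m. f k l))" by (simp add: sum_subtractf)
      hence 1: "vabs (?R - ?Q) \<le> e / 2"
        using m e by (simp only:, intro vabs_sum_le vabs_diff_sums_le[OF row] N) auto
      have 2: "vabs (?Q - ?T) \<le> e / 2"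
      proof -
        \<comment> \<open>The triangle \<open>k + l < m\<close> lies in the square, and outside it an index is at least \<open>N\<close>.\<close>
        have T: "?T = (\<Sum>(k, l)\<in>{(k, l). k + l < m}. f k l)"
          by (rule sum.triangle_reindex[symmetric])
        have Q: "?Q = (\<Sum>(k, l)\<in>{..<m} \<times> {..<m}. f k l)"
          by (simp add: sum.cartesian_product)
        have "?Q - ?T = (\<Sum>(k, l)\<in>{..<m} \<times> {..<m} - {(k, l). k + l < m}. f k l)"
          unfolding T Q by (subst sum_diff) auto
        also have "vabs \<dots> \<le> e / 2"
        proof (rule vabs_sum_le)
          fix z assume "z \<in> {..<m} \<times> {..<m} - {(k, l). k + l < m}"
          moreover obtain k l where "z = (k, l)" by (cases z)
          ultimately have "N \<le> k \<or> N \<le> l" and "z = (k, l)" using m by auto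
          thus "vabs (case z of (k, l) \<Rightarrow> f k l) \<le> e / 2" using N by simp
        qed (use e in auto)
        finally show ?thesis .
      qed
      have 3: "vabs (S - ?T) \<le> e / 2"
      proof (rule vabs_diff_sums_le[OF S])
        fix n assume "m \<le> n"
        show "vabs (\<Sum>k\<le>n. f k (n - k)) \<le> e / 2"
        proof (rule vabs_sum_le)
          fix k assume "k \<in> {..n}"
          have "N \<le> k \<or> N \<le> n - k" using m \<open>m \<le> n\<close> by linarith
          thus "vabs (f k (n - k)) \<le> e / 2" by (rule N)
        qed (use e in auto)
      qed (use e in auto)
      have "vabs (?R - S) \<le> max (vabs (?R - ?Q)) (vabs ((?Q - ?T) - (S - ?T)))"
        using vabs_add[of "?R - ?Q" "(?Q - ?T) - (S - ?T)"] by simp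
      also have "\<dots> \<le> e / 2"
        using vabs_diff[of "?Q - ?T" "S - ?T"] 1 2 3 by simp
      finally show ?thesis using e by (simp add: dist_vabs[of _ S])
    qed
    thus "\<exists>M. \<forall>m\<ge>M. dist (\<Sum>k<m. \<Sum>l. f k l) S < e" by blast
  qed
  thus ?thesis unfolding sums_def S_def .
qed

text \<open>Rows and columns have the same antidiagonals.\<close>

lemma null_family_columns_sums_rows:
  assumes "null_family (f :: nat \<Rightarrow> nat \<Rightarrow> 'k)"
  shows "(\<lambda>l. \<Sum>k. f k l) sums (\<Sum>k. \<Sum>l. f k l)"
proof -
  have "(\<Sum>k\<le>n. f (n - k) k) = (\<Sum>k\<le>n. f k (n - k))" for n
    by (rule sum.reindex_bij_witness[of _ "\<lambda>k. n - k" "\<lambda>k. n - k"]) auto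
  thus ?thesis
    using null_family_rows_sums_antidiagonals[OF assms]
      null_family_rows_sums_antidiagonals[OF null_family_swap[OF assms]]
    by (simp add: sums_iff)
qed

lemma null_family_product:
  assumes a: "a \<longlonglongrightarrow> (0::'k)" and b: "b \<longlonglongrightarrow> (0::'k)"
    and f: "\<And>k l. vabs (f k l :: 'k) \<le> vabs (a k) * vabs (b l)"
  shows "null_family f"
  unfolding null_family_def
proof (intro allI impI)
  fix e :: real assume e: "e > 0"
  have "Bseq (\<lambda>n. vabs (a n))" "Bseq (\<lambda>n. vabs (b n))"
    using a b unfolding tendsto_0_iff_vabs by (auto intro: convergent_imp_Bseq convergentI)
  then obtain A B where A: "A > 0" "\<And>n. vabs (a n) \<le> A" and B: "B > 0" "\<And>n. vabs (b n) \<le> B"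
    by (auto simp: Bseq_def)
  obtain N where N: "\<And>n. n \<ge> N \<Longrightarrow> vabs (a n) < e / B"
    using metric_LIMSEQ_D[OF a, of "e / B"] e B(1) by auto
  obtain M where M: "\<And>n. n \<ge> M \<Longrightarrow> vabs (b n) < e / A"
    using metric_LIMSEQ_D[OF b, of "e / A"] e A(1) by auto
  have "vabs (f k l) \<le> e" if "max M N \<le> k \<or> max M N \<le> l" for k l
  proof -
    have "vabs (a k) * vabs (b l) \<le> e"
    proof (cases "max M N \<le> k")
      case True
      hence "vabs (a k) * vabs (b l) \<le> e / B * B"
        using N[of k] B e by (intro mult_mono) auto
      thus ?thesis using B by simp
    next
      case False
      hence "vabs (a k) * vabs (b l) \<le> A * (e / A)"
        using M[of l] A e that by (intro mult_mono) auto
      thus ?thesis using A by simp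
    qed
    thus ?thesis using f[of k l] by linarith
  qed
  thus "\<exists>N. \<forall>k l. N \<le> k \<or> N \<le> l \<longrightarrow> vabs (f k l) \<le> e" by blast
qed

end

section \<open>The ring of p-adic integers\<close>

locale padic_field = ultrametric_field K
  for K :: "'k::{field_char_0,complete_space} itself" +
  fixes p :: nat
  assumes prime_p: "prime p"
    and vabs_of_rat: "vabs (of_rat q :: 'k) = padic_abs_rat p q"
begin

lemma p_gt_1: "1 < real p"
  using prime_gt_1_nat[OF prime_p] by simp

lemma vabs_of_nat_p: "vabs (of_nat p :: 'k) = 1 / real p"
proof -
  have "p \<noteq> 0" using p_gt_1 by auto
  moreover have "multiplicity (int p) (int p) = 1"
    using p_gt_1 by (intro multiplicity_self) auto
  moreover have "quotient_of (of_nat p) = (int p, 1)"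
    using quotient_of_int[of "int p"] by (simp add: Rat.of_int_def)
  ultimately have "padic_abs_rat p (of_nat p) = 1 / real p"
    by (simp add: padic_abs_rat_def power_int_minus field_simps)
  thus ?thesis using vabs_of_rat[of "of_nat p"] by simp
qed

lemma vabs_p_power_mult_le: "vabs (of_int (int p ^ N * z) :: 'k) \<le> (1 / real p) ^ N"
proof -
  have "vabs (of_int (int p ^ N * z) :: 'k) = (1 / real p) ^ N * vabs (of_int z :: 'k)"
    by (simp add: vabs_mult vabs_power vabs_of_nat_p)
  also have "\<dots> \<le> (1 / real p) ^ N * 1"
    by (intro mult_left_mono vabs_of_int_le_1) auto
  finally show ?thesis by simp
qed

lemma denominator_of_padic_int:
  assumes "vabs (of_rat q :: 'k) \<le> 1"
  shows "\<not> int p dvd snd (quotient_of q)"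
proof
  obtain u v where uv: "quotient_of q = (u, v)" by (cases "quotient_of q")
  assume "int p dvd snd (quotient_of q)"
  hence pv: "int p dvd v" using uv by simp
  have "coprime u v" "v > 0"
    using uv quotient_of_coprime quotient_of_denom_pos by auto
  have pp: "prime (int p)" using prime_p by simp
  have "\<not> int p dvd u"
    using pv \<open>coprime u v\<close> pp by (meson coprime_common_divisor not_prime_unit)
  hence mu: "multiplicity (int p) u = 0" and "u \<noteq> 0"
    by (auto intro: not_dvd_imp_multiplicity_0)
  hence "q \<noteq> 0" using uv by auto
  have "multiplicity (int p) v > 0"
    using pv pp \<open>v > 0\<close> by (simp add: prime_multiplicity_gt_zero_iff)
  hence "padic_abs_rat p q > 1"
    using \<open>q \<noteq> 0\<close> uv mu p_gt_1 by (simp add: padic_abs_rat_def)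
  thus False using assms vabs_of_rat[of q] by simp
qed

text \<open>
  The closure of the rationals is reduced to integers: a rational near \<open>x\<close> has a denominator prime to
  \<open>p\<close>, which is therefore invertible modulo \<open>p ^ N\<close>. The bound \<open>n < p ^ N\<close> makes the net of centres
  finite, which gives compactness.
\<close>

lemma padic_int_approx:
  assumes "x \<in> (padic_ints :: 'k set)"
  shows "\<exists>n<p ^ N. vabs (x - of_nat n) \<le> (1 / real p) ^ N"
proof -
  let ?e = "(1 / real p) ^ N"
  have e: "0 < ?e" "?e \<le> 1" using p_gt_1 by (auto intro: power_le_one)
  have "x \<in> closure (range of_rat)" "vabs x \<le> 1"
    using assms by (auto simp: padic_ints_def padic_rats_def)
  then obtain q where q: "dist (of_rat q) x < ?e"
    using e by (auto simp: closure_approachable)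
  have q': "vabs (x - of_rat q) \<le> ?e"
    using q by (simp add: dist_vabs[of "of_rat q"] vabs_diff_commute)
  have "vabs (of_rat q :: 'k) = vabs (x - (x - of_rat q))" by simp
  also have "\<dots> \<le> 1"
    using vabs_diff[of x "x - of_rat q"] \<open>vabs x \<le> 1\<close> q' e by linarith
  finally have v1: "\<not> int p dvd snd (quotient_of q)" by (rule denominator_of_padic_int)
  obtain u v where uv: "quotient_of q = (u, v)" by (cases "quotient_of q")
  have "v > 0" using uv quotient_of_denom_pos by auto
  have q_eq: "q = of_int u / of_int v" by (rule quotient_of_div[OF uv])
  have pp: "prime (int p)" using prime_p by simp
  have cop: "coprime v (int p)"
    using prime_imp_coprime[OF pp] v1 uv coprime_commute by (metis snd_conv)
  hence "coprime v (int p ^ N)" by simp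
  then obtain a b where ab: "a * v + b * int p ^ N = 1"
    by (metis bezout_int coprime_imp_gcd_eq_1)
  \<comment> \<open>A Bezout relation between \<open>v\<close> and \<open>p\<close> shows that \<open>v\<close> is a unit.\<close>
  have "vabs (of_int v :: 'k) = 1"
  proof -
    obtain c d where "c * v + d * int p = 1"
      using cop by (metis bezout_int coprime_imp_gcd_eq_1)
    hence "(of_int (c * v + d * int p) :: 'k) = 1" by simp
    hence "1 \<le> max (vabs (of_int (c * v) :: 'k)) (vabs (of_int (d * int p) :: 'k))"
      using vabs_add[of "of_int (c * v)" "of_int (d * int p)"] vabs_1 by simp
    moreover have "vabs (of_int (d * int p) :: 'k) < 1"
    proof (rule le_less_trans)
      show "vabs (of_int (d * int p) :: 'k) \<le> 1 / real p"
        using vabs_p_power_mult_le[of 1 d] by (simp add: mult.commute)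
      show "1 / real p < 1" using p_gt_1 by simp
    qed
    ultimately have "1 \<le> vabs (of_int c :: 'k) * vabs (of_int v :: 'k)"
      by (simp add: vabs_mult)
    also have "\<dots> \<le> 1 * vabs (of_int v :: 'k)"
      by (intro mult_right_mono vabs_of_int_le_1) auto
    finally show ?thesis using vabs_of_int_le_1[of v] by simp
  qed
  define w where "w = a * u"
  have "u - v * w = int p ^ N * (b * u)"
    using arg_cong[OF ab, of "\<lambda>z. z * u"] by (simp add: w_def algebra_simps)
  hence "vabs (of_int (u - v * w) :: 'k) \<le> ?e"
    by (simp only: vabs_p_power_mult_le)
  moreover have "(of_rat q :: 'k) - of_int w = of_int (u - v * w) / of_int v"
    using \<open>v > 0\<close> by (simp add: q_eq of_rat_divide field_simps)
  ultimately have qw: "vabs ((of_rat q :: 'k) - of_int w) \<le> ?e"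
    using \<open>v > 0\<close> \<open>vabs (of_int v :: 'k) = 1\<close> by (simp add: vabs_divide)
  define n where "n = nat (w mod int p ^ N)"
  have pN: "int p ^ N > 0" using p_gt_1 by simp
  hence n: "int n = w mod int p ^ N" by (simp add: n_def)
  have "int n < int p ^ N" using pN n by simp
  hence "n < p ^ N" by (metis of_nat_less_iff of_nat_power)
  have "w - int n = int p ^ N * (w div int p ^ N)"
    unfolding n by (simp add: minus_mod_eq_mult_div)
  hence "vabs (of_int (w - int n) :: 'k) \<le> ?e"
    by (simp only: vabs_p_power_mult_le)
  hence wn: "vabs (of_int w - of_nat n :: 'k) \<le> ?e" by simp
  have "vabs (of_rat q - of_nat n :: 'k) \<le> ?e"
    using vabs_add[of "of_rat q - of_int w" "of_int w - of_nat n"] qw wn by simp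
  hence "vabs (x - of_nat n) \<le> ?e"
    using vabs_add[of "x - of_rat q" "of_rat q - of_nat n"] q' by simp
  thus ?thesis using \<open>n < p ^ N\<close> by blast
qed

lemma of_int_in_padic_ints: "of_int z \<in> (padic_ints :: 'k set)"
proof -
  have "(of_rat (of_int z) :: 'k) \<in> closure (range of_rat)"
    by (rule subsetD[OF closure_subset]) (rule rangeI)
  thus ?thesis by (simp add: padic_ints_def padic_rats_def vabs_of_int_le_1)
qed

lemma of_nat_in_padic_ints: "of_nat n \<in> (padic_ints :: 'k set)"
  using of_int_in_padic_ints[of "int n"] by simp

lemma inverse_p_power_tendsto_0: "(\<lambda>N. (1 / real p) ^ N) \<longlonglongrightarrow> 0"
  using p_gt_1 by (intro LIMSEQ_power_zero) auto

lemma compact_padic_ints: "compact (padic_ints :: 'k set)"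
  unfolding compact_eq_totally_bounded
proof (intro conjI allI impI)
  have "padic_ints = closure (range of_rat) \<inter> cball (0::'k) 1"
    by (auto simp: padic_ints_def padic_rats_def dist_commute)
  hence "closed (padic_ints :: 'k set)"
    by (metis closed_Int closed_closure closed_cball)
  thus "complete (padic_ints :: 'k set)"
    by (simp add: complete_eq_closed)
next
  fix e :: real assume "e > 0"
  then obtain N where N: "(1 / real p) ^ N < e"
    using order_tendstoD(2)[OF inverse_p_power_tendsto_0, of e]
    by (auto simp: eventually_sequentially)
  have "padic_ints \<subseteq> (\<Union>x\<in>of_nat ` {..<p ^ N}. ball (x::'k) e)"
  proof
    fix x :: 'k assume "x \<in> padic_ints"
    then obtain n where "n < p ^ N" "vabs (x - of_nat n) \<le> (1 / real p) ^ N"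
      using padic_int_approx by blast
    thus "x \<in> (\<Union>x\<in>of_nat ` {..<p ^ N}. ball (x::'k) e)"
      using N by (auto simp: dist_commute[of _ x] dist_vabs[of x "of_nat _"] intro!: bexI[of _ n])
  qed
  thus "\<exists>k. finite k \<and> (padic_ints :: 'k set) \<subseteq> (\<Union>x\<in>k. ball x e)"
    by (intro exI[of _ "of_nat ` {..<p ^ N}"]) auto
qed

lemma padic_continuous_bounded:
  assumes "\<psi> \<in> (padic_continuous :: ('k \<Rightarrow> 'k) set)"
  obtains M where "0 \<le> M" "\<And>x. x \<in> padic_ints \<Longrightarrow> vabs (\<psi> x) \<le> M"
proof -
  have "compact (\<psi> ` padic_ints)"
    using assms compact_padic_ints
    by (auto simp: padic_continuous_def intro: compact_continuous_image)
  then obtain e where e: "\<And>y. y \<in> \<psi> ` padic_ints \<Longrightarrow> dist 0 y \<le> e"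
    using compact_imp_bounded bounded_any_center by metis
  show ?thesis
    by (rule that[of "max 0 e"]) (use e in \<open>auto simp: dist_commute[of 0] le_max_iff_disj\<close>)
qed

section \<open>Falling factorials and binomial functions\<close>

lemma falling_factorial_Lipschitz:
  assumes "vabs (x::'k) \<le> 1" "vabs y \<le> 1"
  shows "vabs ((\<Prod>i<n. x - of_nat i) - (\<Prod>i<n. y - of_nat i)) \<le> vabs (x - y)"
proof (induction n)
  case (Suc n)
  let ?X = "\<Prod>i<n. x - of_nat i" and ?Y = "\<Prod>i<n. y - of_nat i"
  have le1: "vabs (x - of_nat i) \<le> 1" "vabs (y - of_nat i) \<le> 1" for i
    using vabs_diff[of x "of_nat i"] vabs_diff[of y "of_nat i"] assms vabs_of_nat_le_1[of i]
    by linarith+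
  have Y: "vabs ?Y \<le> 1" unfolding vabs_prod by (intro prod_le_1) (auto simp: le1)
  have "?X * (x - of_nat n) - ?Y * (y - of_nat n) = (?X - ?Y) * (x - of_nat n) + ?Y * (x - y)"
    by (simp add: algebra_simps)
  also have "vabs \<dots> \<le> max (vabs ((?X - ?Y) * (x - of_nat n))) (vabs (?Y * (x - y)))"
    by (rule vabs_add)
  also have "\<dots> \<le> vabs (x - y)"
    using mult_mono[OF Suc le1(1)[of n]] mult_right_mono[OF Y, of "vabs (x - y)"]
    by (simp add: vabs_mult)
  finally show ?case by simp
qed simp

lemma gchoose_eq_falling_factorial: "(x::'k) gchoose n = (\<Prod>i<n. x - of_nat i) / fact n"
  by (simp add: gbinomial_prod_rev atLeast0LessThan)

text \<open>
  Continuity of the binomial function at \<open>x\<close>, along a sequence of naturals: it is a falling factorial,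
  which is 1-Lipschitz on the unit ball, divided by a constant.
\<close>

lemma gchoose_approx:
  assumes "x \<in> (padic_ints :: 'k set)" "\<And>j. vabs (x - of_nat (m j)) \<le> (1 / real p) ^ j"
  shows "(\<lambda>j. (x gchoose n) - (of_nat (m j) gchoose n)) \<longlonglongrightarrow> 0"
proof -
  have "vabs ((x gchoose n) - (of_nat (m j) gchoose n)) \<le> (1 / real p) ^ j / vabs (fact n :: 'k)" for j
  proof -
    have "vabs x \<le> 1" using assms(1) by (simp add: padic_ints_def)
    note L = falling_factorial_Lipschitz[OF this vabs_of_nat_le_1, where n = n]
    have "vabs ((x gchoose n) - (of_nat (m j) gchoose n))
      = vabs ((\<Prod>i<n. x - of_nat i) - (\<Prod>i<n. of_nat (m j) - of_nat i)) / vabs (fact n :: 'k)"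
      unfolding gchoose_eq_falling_factorial diff_divide_distrib[symmetric] by (simp add: vabs_divide)
    also have "\<dots> \<le> (1 / real p) ^ j / vabs (fact n :: 'k)"
      using order_trans[OF L assms(2)] by (intro divide_right_mono) auto
    finally show ?thesis .
  qed
  moreover have "(\<lambda>j. (1 / real p) ^ j / vabs (fact n :: 'k)) \<longlonglongrightarrow> 0"
    using tendsto_divide[OF inverse_p_power_tendsto_0 tendsto_const, of "vabs (fact n :: 'k)"] by simp
  ultimately show ?thesis
    by (rule tendsto_0_if_vabs_le)
qed

lemma padic_int_limit_of_nats:
  assumes "x \<in> (padic_ints :: 'k set)"
  obtains m :: "nat \<Rightarrow> nat" where "\<And>j. vabs (x - of_nat (m j)) \<le> (1 / real p) ^ j"
  using padic_int_approx[OF assms] by metis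

lemma of_nat_gchoose: "(of_nat m :: 'k) gchoose n = of_nat (m choose n)"
  by (simp add: binomial_gbinomial)

text \<open>The values at naturals are integers, and naturals approximate \<open>x\<close>.\<close>

lemma vabs_gchoose_le_1:
  assumes "x \<in> (padic_ints :: 'k set)"
  shows "vabs (x gchoose n) \<le> 1"
proof -
  obtain m where m: "\<And>j. vabs (x - of_nat (m j)) \<le> (1 / real p) ^ j"
    using padic_int_limit_of_nats[OF assms] by blast
  obtain j where j: "vabs ((x gchoose n) - (of_nat (m j) gchoose n)) < 1"
    using metric_LIMSEQ_D[OF gchoose_approx[OF assms m], of 1] by auto
  have "vabs (x gchoose n)
      \<le> max (vabs ((x gchoose n) - (of_nat (m j) gchoose n))) (vabs (of_nat (m j) gchoose n :: 'k))"
    using vabs_add[of "(x gchoose n) - (of_nat (m j) gchoose n)" "of_nat (m j) gchoose n"] by simp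
  thus ?thesis using j vabs_of_nat_le_1[of "m j choose n"] by (simp add: of_nat_gchoose)
qed

text \<open>
  The Gauss norm for radius \<open>1 / p\<close> of a polynomial in \<open>h\<close> is the largest value of
  \<open>vabs (coeff f k) * (1 / p) ^ k\<close>. It is multiplicative; that of \<open>(a - i) + h\<close> is the \<open>i\<close>-th factor
  here, and \<open>gauss_bound a n\<close> is that of the falling factorial of \<open>a + h\<close>.
\<close>

definition gauss_bound :: "'k \<Rightarrow> nat \<Rightarrow> real" where
  "gauss_bound a n = (\<Prod>i<n. max (vabs (a - of_nat i)) (1 / real p))"

lemma gauss_bound_nonneg: "0 \<le> gauss_bound a n"
  unfolding gauss_bound_def by (intro prod_nonneg) (auto simp: le_max_iff_disj)

lemma gauss_bound_antimono:
  assumes "a \<in> padic_ints" "m \<le> n"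
  shows "gauss_bound a n \<le> gauss_bound a m"
proof (rule lift_Suc_antimono_le[of "gauss_bound a", OF _ assms(2)])
  fix n
  have "max (vabs (a - of_nat n)) (1 / real p) \<le> 1"
    using assms(1) vabs_diff[of a "of_nat n"] vabs_of_nat_le_1[of n] p_gt_1
    by (auto simp: padic_ints_def)
  hence "gauss_bound a n * max (vabs (a - of_nat n)) (1 / real p) \<le> gauss_bound a n * 1"
    by (intro mult_left_mono gauss_bound_nonneg)
  thus "gauss_bound a (Suc n) \<le> gauss_bound a n" by (simp add: gauss_bound_def)
qed

text \<open>
  The factor with index \<open>i\<close> equals \<open>1 / p\<close> whenever \<open>i\<close> is congruent modulo \<open>p\<close> to the natural
  \<open>m < p\<close> with \<open>vabs (a - m) \<le> 1 / p\<close>, so each block of \<open>p\<close> factors gains \<open>1 / p\<close>.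
\<close>

lemma gauss_bound_tendsto_0:
  assumes "a \<in> padic_ints"
  shows "gauss_bound a \<longlonglongrightarrow> 0"
proof -
  obtain m where m: "m < p" "vabs (a - of_nat m) \<le> 1 / real p"
    using padic_int_approx[OF assms, of 1] by auto
  have pow: "gauss_bound a (p * q) \<le> (1 / real p) ^ q" for q
  proof (induction q)
    case 0
    show ?case by (simp add: gauss_bound_def)
  next
    case (Suc q)
    let ?i = "p * q + m"
    have "a - of_nat ?i = (a - of_nat m) - of_nat p * of_nat q" by simp
    hence "vabs (a - of_nat ?i) \<le> max (vabs (a - of_nat m)) (vabs (of_nat p * of_nat q :: 'k))"
      by (metis vabs_diff)
    also have "\<dots> \<le> 1 / real p"
      using m(2) vabs_p_power_mult_le[of 1 "int q"] by simp
    finally have i: "max (vabs (a - of_nat ?i)) (1 / real p) = 1 / real p" by simp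
    have "gauss_bound a (p * Suc q) \<le> gauss_bound a (Suc ?i)"
      using m(1) by (intro gauss_bound_antimono[OF assms]) simp
    also have "\<dots> = gauss_bound a ?i * (1 / real p)"
      using i by (simp add: gauss_bound_def)
    also have "\<dots> \<le> (1 / real p) ^ q * (1 / real p)"
      using gauss_bound_antimono[OF assms, of "p * q" ?i] Suc by (intro mult_right_mono) auto
    finally show ?case by (simp add: mult.commute)
  qed
  show ?thesis
  proof (rule metric_LIMSEQ_I)
    fix e :: real assume "e > 0"
    then obtain q where q: "(1 / real p) ^ q < e"
      using order_tendstoD(2)[OF inverse_p_power_tendsto_0, of e]
      by (auto simp: eventually_sequentially)
    have "dist (gauss_bound a n) 0 < e" if "n \<ge> p * q" for n
      using gauss_bound_antimono[OF assms that] pow[of q] q gauss_bound_nonneg[of a n] by simp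
    thus "\<exists>N. \<forall>n\<ge>N. dist (gauss_bound a n) 0 < e" by blast
  qed
qed

text \<open>The polynomial variable stands for \<open>h = x - a\<close>, not for \<open>x\<close>.\<close>

definition falling_poly :: "'k \<Rightarrow> nat \<Rightarrow> 'k poly" where
  "falling_poly a n = (\<Prod>i<n. [:a - of_nat i, 1:])"

lemma poly_falling_poly: "poly (falling_poly a n) (x - a) = fact n * (x gchoose n)"
  by (simp add: falling_poly_def poly_prod gchoose_eq_falling_factorial algebra_simps)

lemma degree_falling_poly: "degree (falling_poly a n) \<le> n"
proof (induction n)
  case (Suc n)
  have "degree (falling_poly a n * [:a - of_nat n, 1:]) \<le> degree (falling_poly a n) + 1"
    using degree_mult_le[of "falling_poly a n" "[:a - of_nat n, 1:]"] by simp
  thus ?case using Suc by (simp add: falling_poly_def)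
qed (simp add: falling_poly_def)

lemma coeff_falling_poly_le:
  "vabs (coeff (falling_poly a n) k) * (1 / real p) ^ k \<le> gauss_bound a n"
proof (induction n arbitrary: k)
  case 0
  show ?case by (cases k) (auto simp: falling_poly_def gauss_bound_def vabs_1)
next
  case (Suc n)
  let ?P = "falling_poly a n" and ?r = "1 / real p" and ?A = "a - of_nat n"
  let ?M = "max (vabs ?A) ?r"
  have P: "falling_poly a (Suc n) = pCons 0 ?P + smult ?A ?P"
    by (simp add: falling_poly_def)
  have B: "gauss_bound a (Suc n) = gauss_bound a n * ?M" by (simp add: gauss_bound_def)
  have 1: "vabs (coeff (smult ?A ?P) k) * ?r ^ k \<le> gauss_bound a n * ?M"
    using mult_mono[OF Suc[of k], of "vabs ?A" ?M] gauss_bound_nonneg[of a n]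
    by (simp add: vabs_mult mult_ac)
  have 2: "vabs (coeff (pCons 0 ?P) k) * ?r ^ k \<le> gauss_bound a n * ?M"
  proof (cases k)
    case 0
    thus ?thesis using gauss_bound_nonneg[of a n] by (simp add: le_max_iff_disj)
  next
    case (Suc j)
    have "vabs (coeff ?P j) * ?r ^ j * ?r \<le> gauss_bound a n * ?M"
      by (intro mult_mono Suc.IH gauss_bound_nonneg) auto
    thus ?thesis using Suc by (simp add: mult_ac)
  qed
  have "vabs (coeff (falling_poly a (Suc n)) k) * ?r ^ k
      \<le> max (vabs (coeff (pCons 0 ?P) k)) (vabs (coeff (smult ?A ?P) k)) * ?r ^ k"
    unfolding P coeff_add by (intro mult_right_mono vabs_add) auto
  thus ?case using 1 2 unfolding B by (auto simp: max_def split: if_splits)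
qed

text \<open>This is the coefficient bound at \<open>k = 0\<close>, where the polynomial takes its value at \<open>h = 0\<close>.\<close>

lemma fact_gchoose_tendsto_0:
  assumes "s \<in> (padic_ints :: 'k set)"
  shows "(\<lambda>n. fact n * (s gchoose n)) \<longlonglongrightarrow> 0"
proof -
  have "vabs (fact n * (s gchoose n)) \<le> gauss_bound s n" for n
    using coeff_falling_poly_le[of s n 0] poly_falling_poly[of s n s] by (simp add: poly_0_coeff_0)
  thus ?thesis by (rule tendsto_0_if_vabs_le) (rule gauss_bound_tendsto_0[OF assms])
qed

section \<open>Mahler expansions\<close>

lemma mahler_series_sums:
  assumes "a \<longlonglongrightarrow> (0::'k)" "x \<in> padic_ints"
  shows "(\<lambda>n. a n * (x gchoose n)) sums (\<Sum>n. a n * (x gchoose n))"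
  by (rule summable_sums, rule null_imp_summable, rule tendsto_0_mult_bounded[OF assms(1)],
      rule vabs_gchoose_le_1[OF assms(2)])

text \<open>
  At a natural \<open>m\<close> the series is finite, and its last coefficient \<open>m choose m\<close> is 1, so the
  coefficients are determined by a triangular system.
\<close>

lemma mahler_coeff_unique:
  assumes "\<And>x. x \<in> (padic_ints :: 'k set) \<Longrightarrow> (\<lambda>n. a n * (x gchoose n)) sums \<phi> x"
    and "\<And>x. x \<in> padic_ints \<Longrightarrow> (\<lambda>n. b n * (x gchoose n)) sums \<phi> x"
  shows "a = b"
proof
  fix m
  show "a m = b m"
  proof (induction m rule: less_induct)
    case (less m)
    have fin: "\<phi> (of_nat m) = c m + (\<Sum>n<m. c n * of_nat (m choose n))"
      if "\<And>x. x \<in> padic_ints \<Longrightarrow> (\<lambda>n. c n * (x gchoose n)) sums \<phi> x" for c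
    proof -
      have "(\<lambda>n. c n * ((of_nat m :: 'k) gchoose n))
          sums (\<Sum>n\<in>{..m}. c n * ((of_nat m :: 'k) gchoose n))"
        by (rule sums_finite) (auto simp: of_nat_gchoose)
      hence "\<phi> (of_nat m) = (\<Sum>n\<in>{..m}. c n * ((of_nat m :: 'k) gchoose n))"
        using that[OF of_nat_in_padic_ints[of m]] sums_unique2 by blast
      thus ?thesis by (simp add: of_nat_gchoose lessThan_Suc_atMost[symmetric] add.commute)
    qed
    have "(\<Sum>n<m. a n * of_nat (m choose n)) = (\<Sum>n<m. b n * of_nat (m choose n))"
      using less by simp
    thus ?case using fin[OF assms(1)] fin[OF assms(2)] by simp
  qed
qed

lemma mahler_coeff_eqI:
  assumes "a \<longlonglongrightarrow> (0::'k)"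
    and "\<And>x. x \<in> padic_ints \<Longrightarrow> (\<lambda>n. a n * (x gchoose n)) sums \<phi> x"
  shows "mahler_coeff \<phi> = a"
  unfolding mahler_coeff_def
  by (rule the_equality) (use assms mahler_coeff_unique in blast)+

lemma mahler_coeff_series:
  assumes "a \<longlonglongrightarrow> (0::'k)"
  shows "mahler_coeff (\<lambda>x. \<Sum>n. a n * (x gchoose n)) = a"
  by (rule mahler_coeff_eqI[OF assms]) (rule mahler_series_sums[OF assms])

end

definition forward_diff :: "(nat \<Rightarrow> 'k::ab_group_add) \<Rightarrow> nat \<Rightarrow> 'k" where
  "forward_diff g m = g (Suc m) - g m"

lemma newton_forward_difference:
  "(g (m + j) :: 'k::comm_ring_1) = (\<Sum>i\<le>j. of_nat (j choose i) * (forward_diff ^^ i) g m)"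
proof (induction j arbitrary: m)
  case (Suc j)
  let ?D = "\<lambda>i. (forward_diff ^^ i) g m"
  have "g (m + Suc j) = g (Suc m + j)" by simp
  also have "\<dots> = (\<Sum>i\<le>j. of_nat (j choose i) * (forward_diff ^^ i) g (Suc m))" by (rule Suc)
  also have "\<dots> = (\<Sum>i\<le>j. of_nat (j choose i) * ?D i) + (\<Sum>i\<le>j. of_nat (j choose i) * ?D (Suc i))"
    by (simp add: forward_diff_def algebra_simps sum.distrib[symmetric])
  also have "(\<Sum>i\<le>j. of_nat (j choose i) * ?D i) = (\<Sum>i\<le>Suc j. of_nat (j choose i) * ?D i)"
    by (simp add: binomial_eq_0)
  also have "\<dots> = ?D 0 + (\<Sum>i\<le>j. of_nat (j choose Suc i) * ?D (Suc i))"
    by (subst sum.atMost_Suc_shift) simp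
  also have "\<dots> + (\<Sum>i\<le>j. of_nat (j choose i) * ?D (Suc i))
      = ?D 0 + (\<Sum>i\<le>j. of_nat (Suc j choose Suc i) * ?D (Suc i))"
    by (simp add: algebra_simps sum.distrib)
  also have "\<dots> = (\<Sum>i\<le>Suc j. of_nat (Suc j choose i) * ?D i)"
    by (simp only: sum.atMost_Suc_shift) simp
  finally show ?case .
qed simp

text \<open>
  In \<open>i * (q choose i) = q * ((q - 1) choose (i - 1))\<close> with \<open>q = p ^ t\<close>, the right-hand side is
  divisible by \<open>p ^ t\<close> but \<open>i\<close> is not.
\<close>

lemma prime_dvd_choose_prime_power:
  assumes "prime (p::nat)" "0 < i" "i < p ^ t"
  shows "p dvd (p ^ t choose i)"
proof (rule ccontr)
  assume "\<not> p dvd (p ^ t choose i)"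
  hence "coprime (p ^ t) (p ^ t choose i)"
    using assms(1) by (simp add: prime_imp_coprime)
  moreover have "p ^ t dvd i * (p ^ t choose i)"
    using times_binomial_minus1_eq[OF assms(2), of "p ^ t"] by simp
  ultimately have "p ^ t dvd i" using coprime_dvd_mult_left_iff by blast
  thus False using assms by (auto dest: dvd_imp_le)
qed

context padic_field
begin

lemma vabs_iterated_forward_diff_le:
  assumes "\<And>m. vabs (g m :: 'k) \<le> c"
  shows "vabs ((forward_diff ^^ n) g m) \<le> c"
proof (induction n arbitrary: m)
  case (Suc n)
  have "vabs ((forward_diff ^^ n) g (Suc m) - (forward_diff ^^ n) g m)
      \<le> max (vabs ((forward_diff ^^ n) g (Suc m))) (vabs ((forward_diff ^^ n) g m))"
    by (rule vabs_diff)
  also have "\<dots> \<le> c" using Suc by simp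
  finally show ?case by (simp add: forward_diff_def[of "(forward_diff ^^ n) g"])
qed (use assms in simp)

lemma iterated_forward_diff_shift:
  "(forward_diff ^^ n) (\<lambda>m. g (m + q) - g m :: 'k)
    = (\<lambda>m. (forward_diff ^^ n) g (m + q) - (forward_diff ^^ n) g m)"
proof (induction n)
  case (Suc n)
  show ?case
    by (rule ext) (simp add: Suc forward_diff_def[of "\<lambda>m. _ (m + q) - _ m"]
        forward_diff_def[of "(forward_diff ^^ n) g"])
qed simp

lemma vabs_of_nat_dvd_le: "p dvd n \<Longrightarrow> vabs (of_nat n :: 'k) \<le> 1 / real p"
  using vabs_p_power_mult_le[of 1 "int (n div p)"] by (simp flip: of_nat_mult)

text \<open>
  One step of Bojanic's argument. Newton's formula for the \<open>k\<close>-th difference, with step \<open>q = p ^ t\<close>,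
  expresses the difference of order \<open>k + q\<close> at 0 by the change of the \<open>k\<close>-th difference under the
  shift by \<open>q\<close>, which is at most \<open>d\<close>, and by differences of orders strictly between \<open>k\<close> and \<open>k + q\<close>
  with coefficients divisible by \<open>p\<close>.
\<close>

lemma iterated_forward_diff_decay:
  assumes shift: "\<And>m. vabs (g (m + p ^ t) - g m :: 'k) \<le> d"
    and C: "\<And>n. n \<ge> n0 \<Longrightarrow> vabs ((forward_diff ^^ n) g 0) \<le> C" and "0 \<le> C"
    and n: "n \<ge> n0 + p ^ t"
  shows "vabs ((forward_diff ^^ n) g 0) \<le> max d (C / real p)"
proof -
  let ?a = "\<lambda>n. (forward_diff ^^ n) g 0" and ?q = "p ^ t"
  obtain k where k: "n = k + ?q" "k \<ge> n0" using n by (metis add.commute le_Suc_ex add.assoc le_add1)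
  have q: "?q > 0" using p_gt_1 by simp
  have "(forward_diff ^^ k) g (0 + ?q)
      = (\<Sum>i\<le>?q. of_nat (?q choose i) * (forward_diff ^^ i) ((forward_diff ^^ k) g) 0)"
    by (rule newton_forward_difference)
  also have "\<dots> = (\<Sum>i\<le>?q. of_nat (?q choose i) * ?a (k + i))"
    by (simp add: funpow_add[of _ k, unfolded o_def] add.commute[of k] funpow_add o_def)
  also have "{..?q} = insert 0 (insert ?q {0<..<?q})" using q by auto
  also have "(\<Sum>i\<in>\<dots>. of_nat (?q choose i) * ?a (k + i))
      = ?a k + (?a n + (\<Sum>i\<in>{0<..<?q}. of_nat (?q choose i) * ?a (k + i)))"
    using q k by simp
  finally have a: "?a n = ((forward_diff ^^ k) g (0 + ?q) - (forward_diff ^^ k) g 0)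
      - (\<Sum>i\<in>{0<..<?q}. of_nat (?q choose i) * ?a (k + i))" by simp
  have 1: "vabs ((forward_diff ^^ k) g (0 + ?q) - (forward_diff ^^ k) g 0) \<le> d"
    using vabs_iterated_forward_diff_le[where g = "\<lambda>m. g (m + ?q) - g m" and c = d and n = k and m = 0,
        OF shift]
    by (simp add: iterated_forward_diff_shift)
  have 2: "vabs (\<Sum>i\<in>{0<..<?q}. of_nat (?q choose i) * ?a (k + i)) \<le> C / real p"
  proof (rule vabs_sum_le)
    fix i assume i: "i \<in> {0<..<?q}"
    have "vabs (of_nat (?q choose i) :: 'k) * vabs (?a (k + i)) \<le> 1 / real p * C"
      using i k \<open>0 \<le> C\<close>
      by (intro mult_mono vabs_of_nat_dvd_le prime_dvd_choose_prime_power C prime_p) auto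
    thus "vabs (of_nat (?q choose i) * ?a (k + i)) \<le> C / real p" by (simp add: vabs_mult)
  qed (use \<open>0 \<le> C\<close> in auto)
  show ?thesis unfolding a
    using vabs_diff[of "(forward_diff ^^ k) g (0 + ?q) - (forward_diff ^^ k) g 0"
        "\<Sum>i\<in>{0<..<?q}. of_nat (?q choose i) * ?a (k + i)"] 1 2 by linarith
qed

lemma iterated_forward_diff_tendsto_0:
  assumes "\<psi> \<in> (padic_continuous :: ('k \<Rightarrow> 'k) set)"
  shows "(\<lambda>n. (forward_diff ^^ n) (\<lambda>m. \<psi> (of_nat m)) 0) \<longlonglongrightarrow> 0"
proof (rule metric_LIMSEQ_I)
  let ?g = "\<lambda>m. \<psi> (of_nat m)"
  fix e :: real assume e: "e > 0"
  obtain M where M: "0 \<le> M" "\<And>x. x \<in> padic_ints \<Longrightarrow> vabs (\<psi> x) \<le> M"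
    using padic_continuous_bounded[OF assms] by blast
  have "uniformly_continuous_on padic_ints \<psi>"
    using assms compact_padic_ints
    by (auto simp: padic_continuous_def intro: compact_uniformly_continuous)
  then obtain d where d: "d > 0"
    "\<And>x y. x \<in> padic_ints \<Longrightarrow> y \<in> padic_ints \<Longrightarrow> dist y x < d \<Longrightarrow> dist (\<psi> y) (\<psi> x) < e / 2"
    using e unfolding uniformly_continuous_on_def by (meson half_gt_zero)
  obtain t where t: "(1 / real p) ^ t < d"
    using order_tendstoD(2)[OF inverse_p_power_tendsto_0 d(1)]
    by (auto simp: eventually_sequentially)
  have shift: "vabs (?g (m + p ^ t) - ?g m) \<le> e / 2" for m
  proof -
    have "vabs (of_nat (m + p ^ t) - of_nat m :: 'k) < d"
      using vabs_p_power_mult_le[of t 1] t by simp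
    hence "dist (?g (m + p ^ t)) (?g m) < e / 2"
      by (intro d(2) of_nat_in_padic_ints) (subst dist_vabs)
    thus ?thesis by (subst (asm) dist_vabs) simp
  qed
  \<comment> \<open>Every \<open>p ^ t\<close> orders the bound improves by \<open>1 / p\<close>, until it reaches \<open>e / 2\<close>.\<close>
  have iter: "\<forall>n\<ge>i * p ^ t. vabs ((forward_diff ^^ n) ?g 0) \<le> max (e / 2) (M * (1 / real p) ^ i)" for i
  proof (induction i)
    case 0
    show ?case
      using vabs_iterated_forward_diff_le[of ?g M] M(2)[OF of_nat_in_padic_ints]
      by (simp add: le_max_iff_disj)
  next
    case (Suc i)
    let ?C = "max (e / 2) (M * (1 / real p) ^ i)"
    have C: "0 \<le> ?C" using e by (simp add: le_max_iff_disj)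
    have "max (e / 2) (?C / real p) \<le> max (e / 2) (M * (1 / real p) ^ Suc i)"
      using p_gt_1 e by (auto simp: max_def field_simps)
    moreover have "vabs ((forward_diff ^^ n) ?g 0) \<le> max (e / 2) (?C / real p)"
      if "n \<ge> Suc i * p ^ t" for n
    proof (rule iterated_forward_diff_decay[where g = ?g and t = t and d = "e / 2" and C = ?C
          and n = n and n0 = "i * p ^ t"])
      show "vabs (?g (m + p ^ t) - ?g m) \<le> e / 2" for m by (rule shift)
    qed (use Suc C that in auto)
    ultimately show ?case by (blast intro: order_trans)
  qed
  have "(\<lambda>i. M * (1 / real p) ^ i) \<longlonglongrightarrow> 0"
    by (rule tendsto_mult_right_zero[OF inverse_p_power_tendsto_0])
  from order_tendstoD(2)[OF this, of "e / 2"] e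
  obtain i where "M * (1 / real p) ^ i < e / 2" by (auto simp: eventually_sequentially)
  hence "vabs ((forward_diff ^^ n) ?g 0) < e" if "n \<ge> i * p ^ t" for n
    using iter[of i] that e by fastforce
  thus "\<exists>N. \<forall>n\<ge>N. dist ((forward_diff ^^ n) ?g 0) 0 < e" by blast
qed

text \<open>
  The coefficients are the iterated differences at 0. Newton's formula is the expansion at naturals. At
  a general \<open>x\<close>, a natural near \<open>x\<close> is chosen such that \<open>\<psi>\<close> and the first \<open>N\<close> terms change
  little; the other terms are small at both points because the coefficients are small.
\<close>

theorem mahler_expansion:
  assumes "\<psi> \<in> (padic_continuous :: ('k \<Rightarrow> 'k) set)"
  shows "mahler_coeff \<psi> \<longlonglongrightarrow> 0"
    and "x \<in> padic_ints \<Longrightarrow> (\<lambda>n. mahler_coeff \<psi> n * (x gchoose n)) sums \<psi> x"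
proof -
  define a where "a n = (forward_diff ^^ n) (\<lambda>m. \<psi> (of_nat m)) 0" for n
  have a0: "a \<longlonglongrightarrow> 0"
    using iterated_forward_diff_tendsto_0[OF assms] by (simp add: a_def[abs_def])
  have nat: "\<psi> (of_nat m) = (\<Sum>n\<le>m. a n * of_nat (m choose n))" for m
    using newton_forward_difference[of "\<lambda>m. \<psi> (of_nat m)" 0 m] by (simp add: a_def mult.commute)
  have sums: "(\<lambda>n. a n * (x gchoose n)) sums \<psi> x" if x: "x \<in> padic_ints" for x
    unfolding sums_def
  proof (rule metric_LIMSEQ_I)
    fix e :: real assume e: "e > 0"
    obtain N where N: "\<And>n. n \<ge> N \<Longrightarrow> vabs (a n) < e / 2"
      using metric_LIMSEQ_D[OF a0, of "e / 2"] e by auto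
    obtain m where m: "\<And>j. vabs (x - of_nat (m j)) \<le> (1 / real p) ^ j"
      using padic_int_limit_of_nats[OF x] by blast
    have "(\<lambda>j. of_nat (m j)) \<longlonglongrightarrow> x"
      unfolding tendsto_dist_iff[of _ x]
      by (rule tendsto_sandwich[OF _ _ tendsto_const inverse_p_power_tendsto_0])
        (use m in \<open>auto simp: dist_commute[of _ x] dist_vabs[of x]\<close>)
    hence "(\<lambda>j. \<psi> (of_nat (m j))) \<longlonglongrightarrow> \<psi> x"
      using assms x of_nat_in_padic_ints
      by (auto simp: padic_continuous_def intro: continuous_on_tendsto_compose)
    hence "\<forall>\<^sub>F j in sequentially. dist (\<psi> (of_nat (m j))) (\<psi> x) < e / 2"
      using e by (intro tendstoD) auto
    moreover have "\<forall>\<^sub>F j in sequentially. \<forall>n\<in>{..<N}.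
        vabs (((x gchoose n) - (of_nat (m j) gchoose n)) * a n) < e / 2"
      using e by (intro eventually_ball_finite ballI finite_lessThan
          tendstoD[OF tendsto_0_mult_bounded[OF gchoose_approx[OF x m] order.refl]]) auto
    ultimately have "\<forall>\<^sub>F j in sequentially. dist (\<psi> (of_nat (m j))) (\<psi> x) < e / 2 \<and>
        (\<forall>n\<in>{..<N}. vabs (((x gchoose n) - (of_nat (m j) gchoose n)) * a n) < e / 2)"
      by (rule eventually_conj)
    then obtain j where j1: "dist (\<psi> (of_nat (m j))) (\<psi> x) < e / 2"
      and j2: "\<And>n. n < N \<Longrightarrow> vabs (((x gchoose n) - (of_nat (m j) gchoose n)) * a n) < e / 2"
      by (auto simp: eventually_sequentially)
    have small: "vabs (a n * c) \<le> e / 2" if "n \<ge> N" "vabs c \<le> 1" for n c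
      using mult_mono[of "vabs (a n)" "e / 2" "vabs c" 1] N[OF that(1)] that(2) e by (simp add: vabs_mult)
    have "dist (\<Sum>n<L. a n * (x gchoose n)) (\<psi> x) < e" if L: "L \<ge> N" for L
    proof -
      let ?z = "of_nat (m j) :: 'k"
      \<comment> \<open>A common range for both finite sums: it contains \<open>L\<close> terms at \<open>x\<close>, and all those at \<open>?z\<close>.\<close>
      define B where "B = L + Suc (m j)"
      have z: "\<psi> ?z = (\<Sum>n<B. a n * (?z gchoose n))"
        unfolding nat of_nat_gchoose B_def
        by (rule sum.mono_neutral_left) (auto simp: not_le)
      have "(\<Sum>n<L. a n * (x gchoose n)) = (\<Sum>n<B. if n < L then a n * (x gchoose n) else 0)"
        by (rule sum.mono_neutral_cong_left) (auto simp: B_def)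
      hence "(\<Sum>n<L. a n * (x gchoose n)) - \<psi> ?z
          = (\<Sum>n<B. (if n < L then a n * (x gchoose n) else 0) - a n * (?z gchoose n))"
        by (simp add: z sum_subtractf)
      also have "vabs \<dots> \<le> e / 2"
      proof (rule vabs_sum_le)
        fix n
        show "vabs ((if n < L then a n * (x gchoose n) else 0) - a n * (?z gchoose n)) \<le> e / 2"
        proof (cases "n < N")
          case True
          thus ?thesis using j2[of n] L by (simp add: algebra_simps)
        next
          case False
          hence n: "n \<ge> N" by simp
          have "vabs (if n < L then a n * (x gchoose n) else 0) \<le> e / 2"
            using small[OF n vabs_gchoose_le_1[OF x]] e by simp
          moreover have "vabs (a n * (?z gchoose n)) \<le> e / 2"
            by (rule small[OF n vabs_gchoose_le_1[OF of_nat_in_padic_ints]])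
          ultimately show ?thesis
            using vabs_diff[of "if n < L then a n * (x gchoose n) else 0" "a n * (?z gchoose n)"]
            by linarith
        qed
      qed (use e in auto)
      finally have "vabs ((\<Sum>n<L. a n * (x gchoose n)) - \<psi> ?z) \<le> e / 2" .
      hence "dist (\<Sum>n<L. a n * (x gchoose n)) (\<psi> ?z) \<le> e / 2"
        by (simp add: dist_vabs[of _ "\<psi> ?z"])
      thus ?thesis using j1 dist_triangle[of "\<Sum>n<L. a n * (x gchoose n)" "\<psi> x" "\<psi> ?z"] by linarith
    qed
    thus "\<exists>L0. \<forall>L\<ge>L0. dist (\<Sum>n<L. a n * (x gchoose n)) (\<psi> x) < e" by blast
  qed
  have "mahler_coeff \<psi> = a" by (rule mahler_coeff_eqI[OF a0 sums])
  thus "mahler_coeff \<psi> \<longlonglongrightarrow> 0"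
    and "x \<in> padic_ints \<Longrightarrow> (\<lambda>n. mahler_coeff \<psi> n * (x gchoose n)) sums \<psi> x"
    using a0 sums by auto
qed

section \<open>The transform as an integral\<close>

lemma minus_one_minus_nat_in_padic_ints: "-1 - of_nat n \<in> (padic_ints :: 'k set)"
  using of_int_in_padic_ints[of "-1 - int n"] by simp

lemma gchoose_minus_one_minus_nat:
  "(-1 - of_nat k :: 'k) gchoose l = (-1) ^ l * of_nat ((k + l) choose k)"
proof -
  have "(-1 - of_nat k :: 'k) gchoose l = (- of_nat (Suc k)) gchoose l" by simp
  also have "\<dots> = (-1) ^ l * (of_nat (k + l) gchoose l)"
    by (subst gbinomial_minus) simp
  also have "\<dots> = (-1) ^ l * of_nat ((k + l) choose k)"
    by (simp only: of_nat_gchoose binomial_symmetric[of k "k + l"] le_add1 diff_add_inverse)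
  finally show ?thesis .
qed

text \<open>
  The coefficient \<open>c k\<close> of \<open>(x - a) ^ k\<close> collects the \<open>k\<close>-th coefficients of all falling factorials.
  The array \<open>f n k\<close> of monomials is a null family: it is bounded by a null sequence in \<open>n\<close>, uniformly
  in \<open>k\<close>, and it vanishes for \<open>k > n\<close>. Its row sums give \<open>I_transform \<psi> x\<close>, its column sums the
  power series.
\<close>

lemma locally_analytic_I_transform:
  assumes "\<psi> \<in> (padic_continuous :: ('k \<Rightarrow> 'k) set)"
  shows "padic_locally_analytic (I_transform \<psi>)"
  unfolding padic_locally_analytic_def
proof (intro ballI)
  fix a :: 'k assume a: "a \<in> padic_ints"
  obtain M where M: "0 \<le> M" "\<And>x. x \<in> padic_ints \<Longrightarrow> vabs (\<psi> x) \<le> M"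
    using padic_continuous_bounded[OF assms] by blast
  let ?y = "\<lambda>n. \<psi> (-1 - of_nat n)"
  have y: "vabs (?y n) \<le> M" for n by (intro M minus_one_minus_nat_in_padic_ints)
  define c where "c k = (\<Sum>n. ?y n * coeff (falling_poly a n) k)" for k
  have Mg: "(\<lambda>n. M * gauss_bound a n) \<longlonglongrightarrow> 0"
    by (rule tendsto_mult_right_zero[OF gauss_bound_tendsto_0[OF a]])
  have bound: "vabs (?y n * coeff (falling_poly a n) k) * (1 / real p) ^ k \<le> M * gauss_bound a n" for n k
    using mult_mono[OF y[of n] coeff_falling_poly_le[of a n k] M(1)]
    by (simp add: vabs_mult mult_ac)
  have c: "(\<lambda>n. ?y n * coeff (falling_poly a n) k) sums c k" for k
    unfolding c_def
  proof (rule summable_sums, rule null_imp_summable, rule tendsto_0_if_vabs_le)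
    show "vabs (?y n * coeff (falling_poly a n) k) \<le> real p ^ k * (M * gauss_bound a n)" for n
      using mult_left_mono[OF bound[of n k], of "real p ^ k"] p_gt_1
      by (simp add: power_divide field_simps)
    show "(\<lambda>n. real p ^ k * (M * gauss_bound a n)) \<longlonglongrightarrow> 0"
      by (rule tendsto_mult_right_zero[OF Mg])
  qed
  have "(\<lambda>k. c k * (x - a) ^ k) sums I_transform \<psi> x"
    if x: "x \<in> padic_ints" "dist x a < 1 / real p" for x
  proof -
    let ?h = "x - a"
    define f where "f n k = ?y n * coeff (falling_poly a n) k * ?h ^ k" for n k
    have h: "vabs ?h < 1 / real p" using x(2) by (simp add: dist_vabs[of x a])
    have f: "vabs (f n k) \<le> M * gauss_bound a n" for n k
    proof -
      have "vabs (f n k) \<le> vabs (?y n * coeff (falling_poly a n) k) * (1 / real p) ^ k"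
        unfolding f_def vabs_mult[of _ "?h ^ k"] vabs_power
        using h by (intro mult_left_mono power_mono) auto
      thus ?thesis using bound[of n k] by linarith
    qed
    have zero: "f n k = 0" if "k > n" for n k
      using that degree_falling_poly[of a n] by (simp add: f_def coeff_eq_0)
    have "null_family f"
      unfolding null_family_def
    proof (intro allI impI)
      fix e :: real assume e: "e > 0"
      obtain N where N: "\<And>n. n \<ge> N \<Longrightarrow> M * gauss_bound a n < e"
        using order_tendstoD(2)[OF Mg e] by (auto simp: eventually_sequentially)
      have "vabs (f n k) \<le> e" if "N \<le> n \<or> N \<le> k" for n k
      proof (cases "N \<le> n")
        case True
        thus ?thesis using f[of n k] N[of n] by linarith
      next
        case False
        thus ?thesis using that zero[of n k] e by simp
      qed
      thus "\<exists>N. \<forall>k l. N \<le> k \<or> N \<le> l \<longrightarrow> vabs (f k l) \<le> e" by blast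
    qed
    hence swap: "(\<lambda>k. \<Sum>n. f n k) sums (\<Sum>n. \<Sum>k. f n k)"
      by (rule null_family_columns_sums_rows)
    have "(\<lambda>n. f n k) sums (c k * ?h ^ k)" for k
      using sums_mult_left[OF c[of k], of "?h ^ k"] by (simp add: f_def mult_ac)
    hence col: "(\<Sum>n. f n k) = c k * ?h ^ k" for k by (simp add: sums_iff)
    have row: "(\<Sum>k. f n k) = fact n * ?y n * (x gchoose n)" for n
    proof -
      have "(\<Sum>k. f n k) = (\<Sum>k\<le>n. f n k)"
        using zero by (intro suminf_finite) auto
      also have "\<dots> = ?y n * poly (falling_poly a n) ?h"
        unfolding f_def poly_altdef sum_distrib_left mult.assoc
        using degree_falling_poly[of a n]
        by (intro sum.mono_neutral_right) (auto simp: coeff_eq_0)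
      also have "\<dots> = fact n * ?y n * (x gchoose n)" by (simp add: poly_falling_poly mult_ac)
      finally show ?thesis .
    qed
    show ?thesis using swap by (simp add: col row I_transform_def)
  qed
  thus "\<exists>r>0. \<exists>c. \<forall>x\<in>padic_ints. dist x a < r \<longrightarrow>
      (\<lambda>n. c n * (x - a) ^ n) sums I_transform \<psi> x"
    using p_gt_1 by (intro exI[of _ "1 / real p"] conjI exI[of _ c]) auto
qed

lemma mahler_coeff_one_minus_star_power:
  assumes "s \<in> (padic_ints :: 'k set)"
  shows "mahler_coeff (one_minus_star_power s) = (\<lambda>n. (-1) ^ n * (s gchoose n) * fact n)"
    and "(\<lambda>n. (-1) ^ n * (s gchoose n) * fact n) \<longlonglongrightarrow> 0"
proof -
  show 0: "(\<lambda>n. (-1) ^ n * (s gchoose n) * fact n) \<longlonglongrightarrow> 0"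
    using tendsto_0_mult_bounded[OF fact_gchoose_tendsto_0[OF assms], of "\<lambda>n. (-1) ^ n" 1]
    by (simp add: vabs_power vabs_minus vabs_1 mult_ac)
  show "mahler_coeff (one_minus_star_power s) = (\<lambda>n. (-1) ^ n * (s gchoose n) * fact n)"
    using mahler_coeff_series[OF 0] by (simp add: one_minus_star_power_def[abs_def])
qed

lemma integral_one_minus_star_power:
  assumes "s \<in> (padic_ints :: 'k set)"
  shows "padic_measure (H_series \<psi>) (one_minus_star_power s) = I_transform \<psi> s"
proof -
  have *: "(-1) ^ n * (s gchoose n) * fact n * ((-1) ^ n * y) = fact n * y * (s gchoose n)" for n and y :: 'k
  proof -
    have "(-1) ^ n * (-1) ^ n = (1::'k)" by (simp flip: power_mult_distrib)
    thus ?thesis by (metis (no_types, lifting) mult.assoc mult.commute mult_1)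
  qed
  show ?thesis
    by (simp only: padic_measure_def I_transform_def H_series_def fps_nth_Abs_fps *
        mahler_coeff_one_minus_star_power[OF assms])
qed

text \<open>
  With \<open>a\<close> and \<open>b\<close> the Mahler coefficients of \<open>\<phi>\<close> and \<open>\<psi>\<close>, the rows of
  \<open>f k l = (-1) ^ (k + l) * ((k + l) choose k) * a k * b l\<close> sum to the terms of the left-hand side by
  Mahler's theorem at \<open>-1 - k\<close>, and its antidiagonals are the terms of the right-hand side. Without the
  sign, the antidiagonal sums are the coefficients of \<open>\<phi> \<star> \<psi>\<close>; that they tend to 0 makes them its
  Mahler coefficients.
\<close>

lemma integral_star_eq:
  assumes \<phi>: "mahler_coeff \<phi> \<longlonglongrightarrow> (0::'k)" and \<psi>: "\<psi> \<in> padic_continuous"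
  shows "padic_measure (H_series \<psi>) \<phi> = padic_measure (H_series (\<lambda>_. 1)) (\<phi> \<star> \<psi>)"
proof -
  let ?a = "mahler_coeff \<phi>" and ?b = "mahler_coeff \<psi>"
  define g where "g k l = of_nat ((k + l) choose k) * ?a k * ?b l" for k l
  define f where "f k l = (-1) ^ (k + l) * g k l" for k l
  have sgn: "vabs ((-1) ^ n :: 'k) = 1" for n by (simp add: vabs_power vabs_minus vabs_1)
  have g_le: "vabs (g k l) \<le> vabs (?a k) * vabs (?b l)" for k l
    using mult_right_mono[OF vabs_of_nat_le_1[of "(k + l) choose k"], of "vabs (?a k) * vabs (?b l)"]
    by (simp add: g_def vabs_mult mult_ac)
  have ng: "null_family g" by (rule null_family_product[OF \<phi> mahler_expansion(1)[OF \<psi>] g_le])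
  have nf: "null_family f"
    by (rule null_family_product[OF \<phi> mahler_expansion(1)[OF \<psi>]]) (simp add: f_def vabs_mult sgn g_le)
  define e where "e n = (\<Sum>k\<le>n. of_nat (n choose k) * ?a k * ?b (n - k))" for n
  have e: "e n = (\<Sum>k\<le>n. g k (n - k))" for n by (simp add: e_def g_def)
  have "e \<longlonglongrightarrow> 0" unfolding e[abs_def] by (rule null_family_antidiagonal[OF ng])
  hence star: "mahler_coeff (\<phi> \<star> \<psi>) = e"
    unfolding mahler_star_def e_def[symmetric] by (rule mahler_coeff_series)
  have row: "(\<Sum>l. f k l) = ?a k * ((-1) ^ k * \<psi> (-1 - of_nat k))" for k
  proof -
    have "(\<lambda>l. ?a k * (-1) ^ k * (?b l * ((-1 - of_nat k) gchoose l)))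
        sums (?a k * (-1) ^ k * \<psi> (-1 - of_nat k))"
      by (intro sums_mult_left mahler_expansion(2)[OF \<psi>] minus_one_minus_nat_in_padic_ints)
    moreover have "?a k * (-1) ^ k * (?b l * ((-1 - of_nat k) gchoose l)) = f k l" for l
      by (simp add: gchoose_minus_one_minus_nat f_def g_def power_add mult_ac)
    ultimately show ?thesis by (simp add: sums_iff mult_ac)
  qed
  have diag: "(\<Sum>k\<le>n. f k (n - k)) = e n * (-1) ^ n" for n
    by (simp add: f_def e sum_distrib_left mult.commute)
  have "(\<Sum>k. \<Sum>l. f k l) = (\<Sum>n. \<Sum>k\<le>n. f k (n - k))"
    using null_family_rows_sums_antidiagonals[OF nf] by (simp add: sums_iff)
  thus ?thesis by (simp add: row diag star padic_measure_def H_series_def)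
qed

end

theorem theorem6p10:
  fixes p :: nat and \<psi> :: "'k::{field_char_0,complete_space} \<Rightarrow> 'k"
  assumes "prime p"
    and "is_complex_padics p TYPE('k)"
    and "\<psi> \<in> padic_continuous"
  shows "padic_locally_analytic (I_transform \<psi>)
    \<and> (\<forall>s \<in> padic_ints.
         I_transform \<psi> s = padic_measure (H_series \<psi>) (one_minus_star_power s)
       \<and> padic_measure (H_series \<psi>) (one_minus_star_power s)
           = padic_measure (H_series (\<lambda>_. 1)) (one_minus_star_power s \<star> \<psi>))"
proof -
  interpret padic_field "TYPE('k)" p
    using assms(1,2) unfolding is_complex_padics_def by unfold_locales blast+
  show ?thesis
    using locally_analytic_I_transform integral_one_minus_star_power
      integral_star_eq mahler_coeff_one_minus_star_power assms(3)
    by (metis (no_types, lifting))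
qed

end
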